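(* Let $\mathbb E=\mathbb R$ or $\mathbb E=\mathbb C$ and let $k>n\ge1$ be integers. The map $\pi:\mathcal F^{\mathbb E}_{k,n}\to\mathcal G^{\mathbb E}_{k,n}$ defined by $\pi(F)=F^*F$ is a surjective, locally trivial fiber bundle with fibers $\mathcal O^{\mathbb E}_n$. Moreover, two frames in $\mathcal F^{\mathbb E}_{k,n}$ have the same image under $\pi$ if and only if they lie in the same orbit of the action of $\mathcal O^{\mathbb E}_n$ on $\mathcal F^{\mathbb E}_{k,n}$. Hence $\mathcal G^{\mathbb E}_{k,n}$ with the relative topology from $M_k(\mathbb E)$ is homeomorphic to the space of orbits of the action of $\mathcal O^{\mathbb E}_n$ on $\mathcal F^{\mathbb E}_{k,n}$, endowed with the quotient topology.
   Context: $\mathcal O^{\mathbb E}_n$ is the group of $n\times n$ orthogonal matrices if $\mathbb E=\mathbb R$ and of $n\times n$ unitary matrices if $\mathbb E=\mathbb C$. A list $F=(f_1,\dots,f_k)$ of vectors in $\mathbb E^n$ is a tight frame if there is $B>0$ with $\sum_{i=1}^k|\langle v,f_i\rangle|^2=B\|v\|^2$ for all $v\in\mathbb E^n$. $F$ is identified with the $n\times k$ matrix whose columns are $f_1,\dots,f_k$. $\mathcal F^{\mathbb E}_{k,n}$ is the space of all (ordered) tight frames of $k$ vectors for $\mathbb E^n$ all lying on the unit sphere of $\mathbb E^n$ (spherical tight frames), with the relative topology from matrices; $\mathcal O^{\mathbb E}_n$ acts on it by left multiplication. $\mathcal G^{\mathbb E}_{k,n}=\{\frac kn P\mid P\in M_k(\mathbb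 E)$ a projection (self-adjoint idempotent) of rank $n$, $P_{ii}=\frac nk$ for $1\le i\le k\}$. *)

theory Defs
  imports "HOL-Analysis.Analysis"
begin

text \<open>
  Both scalar fields are treated by one set of definitions, through a conjugation that is the
  identity on the reals. The class carries no axioms and is used only at its two instances.
\<close>

class conjugation =
  fixes conj :: "'a \<Rightarrow> 'a"

instantiation real :: conjugation
begin
definition conj_real :: "real \<Rightarrow> real" where "conj_real x = x"
instance ..
end

instantiation complex :: conjugation
begin
definition conj_complex :: "complex \<Rightarrow> complex" where "conj_complex z = cnj z"
instance ..
end

definition hinner :: "'a::{real_normed_field,conjugation}^'n \<Rightarrow> 'a^'n \<Rightarrow> 'a" where
  "hinner v w = (\<Sum>i\<in>UNIV. v $ i * conj (w $ i))"

definition ctranspose :: "'a::conjugation^'c^'r \<Rightarrow> 'a^'r^'c" where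
  "ctranspose A = (\<chi> i j. conj (A $ j $ i))"

definition unitary_group :: "('a::{real_normed_field,conjugation}^'n^'n) set" where
  "unitary_group = {U. ctranspose U ** U = mat 1 \<and> U ** ctranspose U = mat 1}"

lemma unitary_group_real:
  "(unitary_group :: (real^'n^'n) set) = {U. orthogonal_matrix U}"
  by (simp add: unitary_group_def orthogonal_matrix_def ctranspose_def transpose_def conj_real_def)

lemma hinner_real: "hinner v w = v \<bullet> w" for v w :: "real^'n"
  by (simp add: hinner_def inner_vec_def conj_real_def)

text \<open>
  A list of vectors indexed by \<open>'k\<close> in the space of dimension \<open>CARD('n)\<close> is the matrix of type
  \<open>'a^'k^'n\<close> (rows indexed by \<open>'n\<close>) having these vectors as columns.
\<close>

definition tight_frame :: "'a::{real_normed_field,conjugation}^'k^'n \<Rightarrow> bool" where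
  "tight_frame F \<longleftrightarrow>
     (\<exists>B>0. \<forall>v. (\<Sum>i\<in>UNIV. (norm (hinner v (column i F)))\<^sup>2) = B * (norm v)\<^sup>2)"

definition spherical_tight_frames :: "('a::{real_normed_field,conjugation}^'k^'n) set" where
  "spherical_tight_frames = {F. tight_frame F \<and> (\<forall>i. norm (column i F) = 1)}"

definition gram :: "'a::{real_normed_field,conjugation}^'k^'n \<Rightarrow> 'a^'k^'k" where
  "gram F = ctranspose F ** F"

definition projection_matrix :: "'a::{real_normed_field,conjugation}^'k^'k \<Rightarrow> bool" where
  "projection_matrix P \<longleftrightarrow> ctranspose P = P \<and> P ** P = P"

definition scaled_projections ::
    "nat \<Rightarrow> ('a::{real_normed_field,conjugation}^'k^'k) set" where
  "scaled_projections n =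
     {(real CARD('k) / real n) *\<^sub>R P | P.
        projection_matrix P \<and> rank P = n \<and> (\<forall>i. P $ i $ i = of_real (real n / real CARD('k)))}"

definition frame_orbit ::
    "'a::{real_normed_field,conjugation}^'k^'n \<Rightarrow> ('a^'k^'n) set" where
  "frame_orbit F = {U ** F | U. U \<in> unitary_group}"

definition quotient_topology :: "'a topology \<Rightarrow> ('a \<Rightarrow> 'b) \<Rightarrow> 'b topology" where
  "quotient_topology X q =
     topology (\<lambda>V. V \<subseteq> q ` topspace X \<and> openin X {x \<in> topspace X. q x \<in> V})"

lemma openin_quotient_topology:
  "openin (quotient_topology X q) V \<longleftrightarrow>
     V \<subseteq> q ` topspace X \<and> openin X {x \<in> topspace X. q x \<in> V}"
proof -
  have "istopology (\<lambda>V. V \<subseteq> q ` topspace X \<and> openin X {x \<in> topspace X. q x \<in> V})"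
    unfolding istopology_def
  proof (intro conjI allI impI)
    fix S T
    assume "S \<subseteq> q ` topspace X \<and> openin X {x \<in> topspace X. q x \<in> S}"
      and "T \<subseteq> q ` topspace X \<and> openin X {x \<in> topspace X. q x \<in> T}"
    moreover have "{x \<in> topspace X. q x \<in> S \<inter> T} =
        {x \<in> topspace X. q x \<in> S} \<inter> {x \<in> topspace X. q x \<in> T}" by blast
    ultimately show "S \<inter> T \<subseteq> q ` topspace X"
      and "openin X {x \<in> topspace X. q x \<in> S \<inter> T}" by auto
  next
    fix \<K>
    assume K: "\<forall>V\<in>\<K>. V \<subseteq> q ` topspace X \<and> openin X {x \<in> topspace X. q x \<in> V}"
    then show "\<Union>\<K> \<subseteq> q ` topspace X" by blast
    have "{x \<in> topspace X. q x \<in> \<Union>\<K>} = (\<Union>V\<in>\<K>. {x \<in> topspace X. q x \<in> V})" by blast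
    then show "openin X {x \<in> topspace X. q x \<in> \<Union>\<K>}" using K by auto
  qed
  then show ?thesis by (simp add: quotient_topology_def topology_inverse')
qed

lemma topspace_quotient_topology: "topspace (quotient_topology X q) = q ` topspace X"
proof -
  have "openin (quotient_topology X q) (q ` topspace X)"
  proof -
    have "{x \<in> topspace X. q x \<in> q ` topspace X} = topspace X" by blast
    then show ?thesis by (simp add: openin_quotient_topology)
  qed
  then show ?thesis
    by (meson openin_quotient_topology openin_subset openin_topspace subset_antisym)
qed

lemma quotient_map_quotient_topology: "quotient_map X (quotient_topology X q) q"
  by (simp add: quotient_map_def topspace_quotient_topology openin_quotient_topology)

definition fiber_bundle ::
    "'e topology \<Rightarrow> 'b topology \<Rightarrow> 'f topology \<Rightarrow> ('e \<Rightarrow> 'b) \<Rightarrow> bool" where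
  "fiber_bundle E B F p \<longleftrightarrow>
     continuous_map E B p \<and>
     (\<forall>b \<in> topspace B. \<exists>U \<phi>. openin B U \<and> b \<in> U \<and>
        homeomorphic_map (subtopology E {e \<in> topspace E. p e \<in> U})
          (prod_topology (subtopology B U) F) \<phi> \<and>
        (\<forall>e \<in> topspace E. p e \<in> U \<longrightarrow> fst (\<phi> e) = p e))"

end

theory Submission
  imports Defs
begin

text \<open>
  With \<open>F\<^sup>*\<close> the adjoint \<^const>\<open>ctranspose\<close> of \<open>F\<close>, and writing \<open>n\<close> and \<open>k\<close> for the number
  of rows and columns of \<open>F\<close>, the frame \<open>F\<close> is tight with constant \<open>B\<close> exactly when
  \<open>F F\<^sup>* = B I\<close>; for unit columns, comparing the traces of \<open>F F\<^sup>*\<close> and \<open>F\<^sup>* F\<close> forces \<open>B = k/n\<close>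
  (\<open>spherical_tight_frames_iff\<close>). Hence \<open>(n/k) F\<^sup>* F\<close> is a projection of rank \<open>n\<close> with constant
  diagonal. If \<open>F\<close> and \<open>F'\<close> have the same Gram matrix, then \<open>(n/k) F' F\<^sup>*\<close> is unitary and
  carries \<open>F\<close> to \<open>F'\<close>, so the fibers of the Gram map are the orbits of the unitary group
  (\<open>gram_eq_imp_transition_unitary\<close>).

  The remaining input is a continuous local section of the Gram map. A frame with Gram matrix
  \<open>(k/n) P\<close> is the same as an orthonormal basis \<open>q\<close> of the range of \<open>P\<close>: put
  \<open>F = sqrt (k/n) Q\<^sup>*\<close>, where \<open>Q\<close> has columns \<open>q\<close>. Such a basis is built by Gram-Schmidt. If
  \<open>q\<^sub>i\<close> (\<open>i \<in> S\<close>) are orthonormal in the range of \<open>P\<close>, then the components \<open>r\<^sub>j\<close> of the columns of \<open>P\<close>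
  orthogonal to all \<open>q\<^sub>i\<close> satisfy \<open>\<Sum>\<^sub>j |r\<^sub>j|\<^sup>2 = trace P - |S|\<close> (\<open>sum_norm_column_residual\<close>). As
  long as \<open>|S| < trace P\<close>, some \<open>r\<^sub>j\<close> is therefore nonzero, and it stays nonzero for all nearby
  projections, so \<open>r\<^sub>j / |r\<^sub>j|\<close> extends the family continuously near the given projection
  (\<open>local_orthonormal_frame\<close>). Once \<open>|S| = trace P\<close>, all \<open>r\<^sub>j\<close> vanish, which says
  \<open>P = \<Sum>\<^sub>i q\<^sub>i q\<^sub>i\<^sup>*\<close>. This gives surjectivity and the section at once (\<open>gram_local_section\<close>).

  A local section \<open>s\<close> yields the local trivialization
  \<open>F \<mapsto> (F\<^sup>* F, (n/k) F (s (F\<^sup>* F))\<^sup>*)\<close>, with inverse \<open>(G, V) \<mapsto> V s(G)\<close>. Finally, a bundle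
  projection is open, so the Gram map is a quotient map, and it has the same fibers as the
  quotient map onto the orbit space; two such quotient maps have homeomorphic targets.
\<close>

section \<open>Conjugation on the scalar field\<close>

text \<open>
  The scalar fields \<open>\<real>\<close> and \<open>\<complex>\<close> at once: a normed field with a real-linear multiplicative
  involution for which \<open>x * conj x\<close> is the squared norm.
\<close>

class involutive_normed_field = real_normed_field + conjugation +
  assumes conj_add: "conj (x + y) = conj x + conj y"
    and conj_mult: "conj (x * y) = conj x * conj y"
    and conj_scaleR: "conj (r *\<^sub>R x) = r *\<^sub>R conj x"
    and conj_conj [simp]: "conj (conj x) = x"
    and mult_conj_scaleR: "x * conj x = (norm x)\<^sup>2 *\<^sub>R 1"

instance real :: involutive_normed_field
  by standard (auto simp: conj_real_def power2_eq_square)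

instance complex :: involutive_normed_field
  by standard (auto simp: conj_complex_def complex_norm_square scaleR_conv_of_real simp flip: of_real_power)

lemma mult_conj: "x * conj x = of_real ((norm x)\<^sup>2)" for x :: "'a::involutive_normed_field"
  by (simp add: mult_conj_scaleR scaleR_conv_of_real)

lemma conj_0 [simp]: "conj 0 = (0 :: 'a::involutive_normed_field)"
  using conj_add[of "0::'a" 0] by simp

lemma conj_1 [simp]: "conj 1 = (1 :: 'a::involutive_normed_field)"
  using mult_conj[of "1::'a"] by simp

lemma conj_minus: "conj (- x) = - conj x" for x :: "'a::involutive_normed_field"
  using conj_scaleR[of "-1" x] by simp

lemma conj_diff: "conj (x - y) = conj x - conj y" for x :: "'a::involutive_normed_field"
  using conj_add[of x "- y"] by (simp add: conj_minus)

lemma conj_sum: "conj (sum f A) = (\<Sum>a\<in>A. conj (f a :: 'a::involutive_normed_field))"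
  by (induction A rule: infinite_finite_induct) (auto simp: conj_add)

lemma norm_conj [simp]: "norm (conj x) = norm x" for x :: "'a::involutive_normed_field"
proof -
  have "norm x * norm (conj x) = norm x * norm x"
    using arg_cong[OF mult_conj[of x], of norm] by (simp add: norm_mult power2_eq_square)
  then show ?thesis
    by (cases "x = 0") auto
qed

lemma continuous_on_conj [continuous_intros]:
  fixes f :: "'b::topological_space \<Rightarrow> 'a::involutive_normed_field"
  assumes "continuous_on S f"
  shows "continuous_on S (\<lambda>x. conj (f x))"
proof -
  have "continuous_on UNIV (conj :: 'a \<Rightarrow> 'a)"
    unfolding continuous_on_iff dist_norm by (metis conj_diff norm_conj)
  then show ?thesis
    using assms continuous_on_compose2 by blast
qed

section \<open>The Hermitian form and the adjoint matrix\<close>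

lemma hinner_self: "hinner v v = of_real ((norm v)\<^sup>2)"
  for v :: "'a::involutive_normed_field^'n"
  by (simp add: hinner_def mult_conj norm_vec_def L2_set_def sum_nonneg)

lemma hinner_add_left: "hinner (u + v) w = hinner u w + hinner v w"
  and hinner_diff_left: "hinner (u - v) w = hinner u w - hinner v w"
  and hinner_smult_left: "hinner (c *s v) w = c * hinner v w"
  and hinner_scaleR_left: "hinner (r *\<^sub>R v) w = r *\<^sub>R hinner v w"
  and hinner_sum_left: "hinner (\<Sum>i\<in>A. f i) w = (\<Sum>i\<in>A. hinner (f i) w)"
  for v :: "'a::involutive_normed_field^'n"
  by (auto simp: hinner_def algebra_simps sum.distrib sum_subtractf sum_distrib_left scaleR_sum_right
      sum_distrib_right intro: sum.swap)

lemma conj_hinner: "conj (hinner v w) = hinner w v"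
  for v :: "'a::involutive_normed_field^'n"
  by (simp add: hinner_def conj_sum conj_mult mult.commute)

lemma hinner_add_right: "hinner w (u + v) = hinner w u + hinner w v"
  and hinner_diff_right: "hinner w (u - v) = hinner w u - hinner w v"
  and hinner_sum_right: "hinner w (\<Sum>i\<in>A. f i) = (\<Sum>i\<in>A. hinner w (f i))"
  for v :: "'a::involutive_normed_field^'n"
  by (auto simp: hinner_def conj_add conj_diff conj_scaleR conj_sum algebra_simps sum.distrib 
      sum_subtractf sum_distrib_left scaleR_sum_right intro: sum.swap)

lemma hinner_smult_right: "hinner w (c *s v) = conj c * hinner w v"
  for v :: "'a::involutive_normed_field^'n"
  by (simp add: hinner_def conj_mult sum_distrib_left algebra_simps)

lemma ctranspose_ctranspose [simp]: "ctranspose (ctranspose A) = A"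
  for A :: "'a::involutive_normed_field^'m^'n"
  by (simp add: ctranspose_def vec_eq_iff)

lemma ctranspose_mult: "ctranspose (A ** B) = ctranspose B ** ctranspose A"
  for A :: "'a::involutive_normed_field^'m^'n"
  by (simp add: ctranspose_def matrix_matrix_mult_def vec_eq_iff conj_sum conj_mult mult.commute)

lemma ctranspose_scaleR: "ctranspose (r *\<^sub>R A) = r *\<^sub>R ctranspose A"
  for A :: "'a::involutive_normed_field^'m^'n"
  by (simp add: ctranspose_def vec_eq_iff conj_scaleR)

lemma ctranspose_diff: "ctranspose (A - B) = ctranspose A - ctranspose B"
  for A :: "'a::involutive_normed_field^'m^'n"
  by (simp add: ctranspose_def vec_eq_iff conj_diff)

lemma ctranspose_mat_1 [simp]: "ctranspose (mat 1) = (mat 1 :: 'a::involutive_normed_field^'n^'n)"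
  by (simp add: ctranspose_def vec_eq_iff mat_def)

lemma hinner_matrix_vector_mult: "hinner (A *v v) w = hinner v (ctranspose A *v w)"
  for A :: "'a::involutive_normed_field^'m^'n"
proof -
  have "hinner (A *v v) w = (\<Sum>i\<in>UNIV. \<Sum>j\<in>UNIV. A $ i $ j * v $ j * conj (w $ i))"
    by (simp add: hinner_def matrix_vector_mult_def sum_distrib_right)
  also have "\<dots> = (\<Sum>j\<in>UNIV. \<Sum>i\<in>UNIV. A $ i $ j * v $ j * conj (w $ i))"
    by (rule sum.swap)
  also have "\<dots> = hinner v (ctranspose A *v w)"
    by (simp add: hinner_def matrix_vector_mult_def ctranspose_def conj_sum conj_mult
        sum_distrib_left algebra_simps)
  finally show ?thesis .
qed

lemma scaleR_matrix_mult_left: "(r *\<^sub>R A) ** B = r *\<^sub>R (A ** B)"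
  and scaleR_matrix_mult_right: "A ** (r *\<^sub>R B) = r *\<^sub>R (A ** B)"
  for A :: "'a::real_normed_field^'m^'n"
  by (simp_all add: matrix_matrix_mult_def vec_eq_iff scaleR_sum_right)

lemma scaleR_matrix_vector_mult: "(r *\<^sub>R A) *v v = r *\<^sub>R (A *v v)"
  for A :: "'a::real_normed_field^'m^'n"
  by (simp add: matrix_vector_mult_def vec_eq_iff scaleR_sum_right)

lemma scaleR_matrix_vector_mult_right: "A *v (r *\<^sub>R v) = r *\<^sub>R (A *v v)"
  for A :: "'a::real_normed_field^'m^'n"
  by (simp add: matrix_vector_mult_def vec_eq_iff scaleR_sum_right)

lemma continuous_on_matrix_mult [continuous_intros]:
  fixes f :: "'b::topological_space \<Rightarrow> 'a::real_normed_field^'m^'n"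
  assumes "continuous_on S f" "continuous_on S g"
  shows "continuous_on S (\<lambda>x. f x ** g x)"
  unfolding matrix_matrix_mult_def by (intro continuous_intros assms)

lemma continuous_on_ctranspose [continuous_intros]:
  fixes f :: "'b::topological_space \<Rightarrow> 'a::involutive_normed_field^'m^'n"
  assumes "continuous_on S f"
  shows "continuous_on S (\<lambda>x. ctranspose (f x))"
  unfolding ctranspose_def by (intro continuous_intros assms)

lemma trace_scaleR: "trace (r *\<^sub>R A) = r *\<^sub>R trace A"
  for A :: "'a::real_normed_field^'n^'n"
  by (simp add: trace_def scaleR_sum_right)

lemma hermitian_form_zero_imp_zero:
  fixes A :: "'a::involutive_normed_field^'n^'n"
  assumes "ctranspose A = A" "\<And>v. hinner (A *v v) v = 0"
  shows "A = 0"
proof -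
  have "A *v u = 0" for u
  proof -
    \<comment> \<open>Expanding the form at \<open>u + A u\<close> leaves twice the squared norm of \<open>A u\<close>.\<close>
    let ?w = "A *v u"
    have "hinner (A *v (u + ?w)) (u + ?w) = 0"
      by (rule assms(2))
    then have "hinner (A *v u) ?w + hinner (A *v ?w) u = 0"
      by (simp add: matrix_vector_right_distrib hinner_add_left hinner_add_right assms(2) add.commute)
    then have "2 * hinner ?w ?w = 0"
      by (simp add: hinner_matrix_vector_mult[of A ?w] assms(1))
    then show ?thesis
      by (simp add: hinner_self)
  qed
  then show ?thesis
    by (metis matrix_eq matrix_vector_mult_0)
qed

section \<open>Spherical tight frames in terms of matrices\<close>

lemma hinner_column: "hinner v (column i F) = (ctranspose F *v v) $ i"
  for F :: "'a::involutive_normed_field^'k^'n"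
  by (simp add: hinner_def column_def ctranspose_def matrix_vector_mult_def mult.commute)

lemma gram_diag: "gram F $ i $ i = of_real ((norm (column i F))\<^sup>2)"
  for F :: "'a::involutive_normed_field^'k^'n"
  unfolding hinner_self[symmetric]
  by (simp add: gram_def hinner_def column_def ctranspose_def matrix_matrix_mult_def mult.commute)

lemma tight_frame_iff:
  fixes F :: "'a::involutive_normed_field^'k^'n"
  shows "tight_frame F \<longleftrightarrow> (\<exists>B>0. F ** ctranspose F = B *\<^sub>R mat 1)"
proof -
  have "(\<forall>v. (\<Sum>i\<in>UNIV. (norm (hinner v (column i F)))\<^sup>2) = B * (norm v)\<^sup>2) \<longleftrightarrow>
      F ** ctranspose F = B *\<^sub>R mat 1" for B
  proof -
    let ?A = "F ** ctranspose F - B *\<^sub>R mat 1"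
    have sum: "(\<Sum>i\<in>UNIV. (norm (hinner v (column i F)))\<^sup>2) = (norm (ctranspose F *v v))\<^sup>2" for v
      by (simp add: hinner_column norm_vec_def L2_set_def sum_nonneg)
    have form: "hinner (?A *v v) v = of_real ((norm (ctranspose F *v v))\<^sup>2 - B * (norm v)\<^sup>2)" for v
    proof -
      have "?A *v v = F *v (ctranspose F *v v) - B *\<^sub>R v"
        by (simp add: matrix_vector_mult_diff_rdistrib matrix_vector_mul_assoc
            scaleR_matrix_vector_mult)
      then show ?thesis
        by (simp add: hinner_diff_left hinner_scaleR_left hinner_matrix_vector_mult[of F] hinner_self
            scaleR_conv_of_real[where 'a = 'a])
    qed
    have "ctranspose ?A = ?A"
      by (simp add: ctranspose_diff ctranspose_mult ctranspose_scaleR)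
    then have "?A = 0 \<longleftrightarrow> (\<forall>v. hinner (?A *v v) v = 0)"
      using hermitian_form_zero_imp_zero[of ?A] by (auto simp: hinner_def)
    then show ?thesis
      unfolding sum form of_real_eq_0_iff by simp
  qed
  then show ?thesis
    unfolding tight_frame_def by simp
qed

lemma spherical_tight_frames_iff:
  fixes F :: "'a::involutive_normed_field^'k^'n"
  shows "F \<in> spherical_tight_frames \<longleftrightarrow>
    F ** ctranspose F = (real CARD('k) / real CARD('n)) *\<^sub>R mat 1 \<and> (\<forall>i. gram F $ i $ i = 1)"
proof -
  have unit: "norm (column i F) = 1 \<longleftrightarrow> gram F $ i $ i = 1" for i
    using norm_ge_zero[of "column i F"]
    unfolding gram_diag of_real_eq_1_iff power2_eq_1_iff by linarith
  have "B = real CARD('k) / real CARD('n)"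
    if B: "F ** ctranspose F = B *\<^sub>R mat 1" and 1: "\<forall>i. gram F $ i $ i = 1" for B
  proof -
    have "of_nat CARD('k) = trace (gram F)"
      using 1 by (simp add: trace_def)
    also have "\<dots> = trace (F ** ctranspose F)"
      unfolding gram_def by (rule trace_mul_sym)
    also have "\<dots> = of_real (B * real CARD('n))"
      by (simp add: B trace_scaleR trace_I scaleR_conv_of_real[where 'a = 'a])
    finally have "(of_real (real CARD('k)) :: 'a) = of_real (B * real CARD('n))"
      by simp
    then have "real CARD('k) = B * real CARD('n)"
      by (simp only: of_real_eq_iff)
    then show ?thesis
      by (simp add: field_simps)
  qed
  moreover have "0 < real CARD('k) / real CARD('n)"
    by simp
  ultimately show ?thesis
    unfolding spherical_tight_frames_def mem_Collect_eq tight_frame_iff unit by blast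
qed

lemma gram_unitary_mult:
  fixes F :: "'a::involutive_normed_field^'k^'n"
  assumes "U \<in> unitary_group"
  shows "gram (U ** F) = gram F"
proof -
  have "gram (U ** F) = ctranspose F ** (ctranspose U ** U) ** F"
    by (simp add: gram_def ctranspose_mult matrix_mul_assoc)
  then show ?thesis
    using assms by (simp add: unitary_group_def gram_def)
qed

lemma unitary_mult_spherical_tight_frame:
  fixes F :: "'a::involutive_normed_field^'k^'n"
  assumes U: "U \<in> unitary_group" and F: "F \<in> spherical_tight_frames"
  shows "U ** F \<in> spherical_tight_frames"
proof -
  have "(U ** F) ** ctranspose (U ** F) = U ** (F ** ctranspose F) ** ctranspose U"
    by (simp add: ctranspose_mult matrix_mul_assoc)
  also have "\<dots> = (real CARD('k) / real CARD('n)) *\<^sub>R mat 1"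
    using U F by (simp add: spherical_tight_frames_iff scaleR_matrix_mult_left
        scaleR_matrix_mult_right unitary_group_def)
  finally show ?thesis
    using U F by (simp add: spherical_tight_frames_iff gram_unitary_mult)
qed

text \<open>
  Since \<open>F F\<^sup>* = (k/n) I\<close>, a unitary \<open>U\<close> with \<open>U F = F'\<close> can only be \<open>(n/k) F' F\<^sup>*\<close>.
\<close>

lemma gram_eq_imp_transition_unitary:
  fixes F F' :: "'a::involutive_normed_field^'k^'n"
  assumes F: "F \<in> spherical_tight_frames" and F': "F' \<in> spherical_tight_frames"
    and eq: "gram F = gram F'"
  defines "U \<equiv> (real CARD('n) / real CARD('k)) *\<^sub>R (F' ** ctranspose F)"
  shows "U \<in> unitary_group" "U ** F = F'"
proof -
  have unitary: "((real CARD('n) / real CARD('k)) *\<^sub>R (B ** ctranspose A)) **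
      ctranspose ((real CARD('n) / real CARD('k)) *\<^sub>R (B ** ctranspose A)) = mat 1"
    if "A \<in> spherical_tight_frames" "B \<in> spherical_tight_frames" "gram A = gram B"
    for A B :: "'a^'k^'n"
  proof -
    have "(B ** ctranspose A) ** ctranspose (B ** ctranspose A) =
        B ** gram A ** ctranspose B"
      by (simp add: gram_def ctranspose_mult matrix_mul_assoc)
    also have "\<dots> = (B ** ctranspose B) ** (B ** ctranspose B)"
      unfolding that(3) by (simp add: gram_def matrix_mul_assoc)
    finally show ?thesis
      using that by (simp add: spherical_tight_frames_iff ctranspose_scaleR
          scaleR_matrix_mult_left scaleR_matrix_mult_right)
  qed
  have "ctranspose U = (real CARD('n) / real CARD('k)) *\<^sub>R (F ** ctranspose F')"
    by (simp add: U_def ctranspose_scaleR ctranspose_mult)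
  then show "U \<in> unitary_group"
    using unitary[OF F F' eq] unitary[OF F' F eq[symmetric]]
    by (simp add: unitary_group_def U_def ctranspose_scaleR ctranspose_mult)
  have "U ** F = (real CARD('n) / real CARD('k)) *\<^sub>R (F' ** gram F)"
    by (simp add: U_def gram_def scaleR_matrix_mult_left matrix_mul_assoc)
  also have "F' ** gram F = (F' ** ctranspose F') ** F'"
    unfolding eq by (simp add: gram_def matrix_mul_assoc)
  finally show "U ** F = F'"
    using F' by (simp add: spherical_tight_frames_iff scaleR_matrix_mult_left)
qed

lemma frame_orbit_eq_gram_fiber:
  fixes F :: "'a::involutive_normed_field^'k^'n"
  assumes "F \<in> spherical_tight_frames"
  shows "frame_orbit F = {F' \<in> spherical_tight_frames. gram F' = gram F}"
  using assms gram_eq_imp_transition_unitary[OF assms]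
  unfolding frame_orbit_def
  by (auto simp: gram_unitary_mult unitary_mult_spherical_tight_frame) metis

section \<open>Gram matrices are scaled projections\<close>

lemma rows_matrix_mult_subset_span: "rows (A ** B) \<subseteq> vec.span (rows B)"
  for A :: "'a::field^'m^'n"
proof -
  have "row i (A ** B) = (\<Sum>j\<in>UNIV. A $ i $ j *s row j B)" for i
    by (simp add: vec_eq_iff row_def matrix_matrix_mult_def)
  moreover have "(\<Sum>j\<in>UNIV. A $ i $ j *s row j B) \<in> vec.span (rows B)" for i
    by (intro vec.span_sum vec.span_scale vec.span_base) (auto simp: rows_def)
  ultimately show ?thesis
    by (auto simp: rows_def)
qed

lemma rank_matrix_mult_le_right: "rank (A ** B) \<le> rank B"
  for A :: "'a::field^'m^'n"
  unfolding row_rank_def_gen by (rule vec.dim_mono) (rule rows_matrix_mult_subset_span)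

lemma rank_right_invertible:
  fixes A :: "'a::field^'m^'n"
  assumes "A ** B = mat 1"
  shows "rank A = CARD('n)"
proof -
  have zero: "c i = 0" if "(\<Sum>i\<in>UNIV. c i *s row i A) = 0" for c i
    using assms matrix_right_invertible_independent_rows that by blast
  have inj: "inj (\<lambda>i. row i A)"
  proof
    fix i j assume eq: "row i A = row j A"
    show "i = j"
    proof (rule ccontr)
      assume "i \<noteq> j"
      let ?c = "\<lambda>l. if l = i then 1 else if l = j then - 1 else (0::'a)"
      have "(\<Sum>l\<in>UNIV. ?c l *s row l A) = (\<Sum>l\<in>{i,j}. ?c l *s row l A)"
        by (rule sum.mono_neutral_right) auto
      also have "\<dots> = 0"
        using \<open>i \<noteq> j\<close> eq by simp
      finally show False
        using zero[of ?c i] by simp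
    qed
  qed
  have rows: "rows A = range (\<lambda>i. row i A)"
    by (auto simp: rows_def)
  have "vec.independent (rows A)"
  proof (rule vec.independent_if_scalars_zero)
    show "finite (rows A)"
      by (simp add: rows)
    fix f x
    assume "(\<Sum>x\<in>rows A. f x *s x) = 0" and x: "x \<in> rows A"
    then have "(\<Sum>i\<in>UNIV. f (row i A) *s row i A) = 0"
      unfolding rows by (subst (asm) sum.reindex[OF inj]) simp
    with x show "f x = 0"
      unfolding rows using zero[of "\<lambda>i. f (row i A)"] by blast
  qed
  then show ?thesis
    unfolding row_rank_def_gen by (simp add: vec.dim_eq_card_independent rows card_image[OF inj])
qed

lemma gram_in_scaled_projections:
  fixes F :: "'a::involutive_normed_field^'k^'n"
  assumes F: "F \<in> spherical_tight_frames"
  shows "gram F \<in> scaled_projections CARD('n)"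
proof -
  let ?c = "real CARD('n) / real CARD('k)"
  define P where "P = ?c *\<^sub>R gram F"
  have FF: "F ** ctranspose F = (real CARD('k) / real CARD('n)) *\<^sub>R mat 1"
    and diag: "gram F $ i $ i = 1" for i
    using F by (auto simp: spherical_tight_frames_iff)
  have FP: "F ** P = F"
    by (simp add: P_def gram_def scaleR_matrix_mult_right matrix_mul_assoc FF
        scaleR_matrix_mult_left)
  have "P ** P = ?c *\<^sub>R (ctranspose F ** (F ** P))"
    by (simp add: P_def gram_def scaleR_matrix_mult_left matrix_mul_assoc)
  also have "\<dots> = P"
    unfolding FP by (simp add: P_def gram_def)
  finally have "P ** P = P" .
  moreover have "ctranspose P = P"
    by (simp add: P_def gram_def ctranspose_scaleR ctranspose_mult)
  ultimately have "projection_matrix P"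
    by (simp add: projection_matrix_def)
  moreover have "rank P = CARD('n)"
  proof (rule antisym)
    have rank_F: "rank F = CARD('n)"
      by (rule rank_right_invertible[of F "?c *\<^sub>R ctranspose F"])
        (simp add: scaleR_matrix_mult_right FF)
    have "P = (?c *\<^sub>R ctranspose F) ** F"
      by (simp add: P_def gram_def scaleR_matrix_mult_left)
    then show "rank P \<le> CARD('n)"
      using rank_matrix_mult_le_right[of "?c *\<^sub>R ctranspose F" F] by (simp add: rank_F)
    show "CARD('n) \<le> rank P"
      using rank_matrix_mult_le_right[of F P] by (simp add: FP rank_F)
  qed
  moreover have "\<forall>i. P $ i $ i = of_real ?c"
    by (simp add: P_def diag scaleR_conv_of_real[where 'a = 'a])
  moreover have "gram F = (real CARD('k) / real CARD('n)) *\<^sub>R P"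
    by (simp add: P_def)
  ultimately show ?thesis
    unfolding scaled_projections_def by blast
qed

section \<open>Local orthonormal frames of the range of a projection\<close>

text \<open>
  The vectors \<open>q i\<close> with \<open>i \<in> S\<close> are orthonormal and fixed by \<open>P\<close>; for a projection the latter
  means that they lie in its range.
\<close>

definition orthonormal_in_range ::
    "'a::{real_normed_field,conjugation}^'k^'k \<Rightarrow> ('i \<Rightarrow> 'a^'k) \<Rightarrow> 'i set \<Rightarrow> bool" where
  "orthonormal_in_range P q S \<longleftrightarrow> (\<forall>i\<in>S. P *v q i = q i) \<and>
     (\<forall>i\<in>S. \<forall>j\<in>S. hinner (q i) (q j) = (if i = j then 1 else 0))"

text \<open>
  For an orthonormal family \<open>q\<close> in the range of a Hermitian projection \<open>P\<close>, this is the component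
  of the \<open>j\<close>-th column of \<open>P\<close> orthogonal to all \<open>q i\<close> with \<open>i \<in> S\<close>: the Fourier coefficient
  \<open>hinner (column j P) (q i)\<close> is then \<open>conj (q i $ j)\<close>.
\<close>

definition column_residual ::
    "'a::{real_normed_field,conjugation}^'k^'k \<Rightarrow> ('i \<Rightarrow> 'a^'k) \<Rightarrow> 'i set \<Rightarrow> 'k \<Rightarrow> 'a^'k" where
  "column_residual P q S j = column j P - (\<Sum>i\<in>S. conj (q i $ j) *s q i)"

context
  fixes P :: "'a::involutive_normed_field^'k^'k" and q :: "'i \<Rightarrow> 'a^'k" and S :: "'i set"
  assumes P: "projection_matrix P" and q: "orthonormal_in_range P q S" and S: "finite S"
begin

lemma projection_mult_column: "P *v column j P = column j P"
proof -
  have "P *v column j P = column j (P ** P)"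
    by (simp add: vec_eq_iff column_def matrix_vector_mult_def matrix_matrix_mult_def)
  then show ?thesis
    using P by (simp add: projection_matrix_def)
qed

lemma hinner_column_projection: "P *v v = v \<Longrightarrow> hinner v (column j P) = v $ j"
  using P by (simp add: hinner_column projection_matrix_def)

lemma projection_mult_column_residual:
  "P *v column_residual P q S j = column_residual P q S j"
proof -
  have "P *v (\<Sum>i\<in>S. conj (q i $ j) *s q i) = (\<Sum>i\<in>S. conj (q i $ j) *s q i)"
    using q by (simp add: vec.linear_sum vec.linear_scale orthonormal_in_range_def)
  then show ?thesis
    by (simp add: column_residual_def matrix_vector_mult_diff_distrib projection_mult_column)
qed

lemma hinner_column_residual:
  assumes "l \<in> S"
  shows "hinner (column_residual P q S j) (q l) = 0"
proof -
  have "hinner (column j P) (q l) = conj (q l $ j)"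
    using q assms hinner_column_projection[of "q l" j]
    by (simp add: orthonormal_in_range_def flip: conj_hinner[of "q l"])
  moreover have "(\<Sum>i\<in>S. conj (q i $ j) * hinner (q i) (q l)) =
      (\<Sum>i\<in>S. if i = l then conj (q i $ j) else 0)"
    using q assms by (intro sum.cong) (auto simp: orthonormal_in_range_def)
  ultimately show ?thesis
    using assms S
    by (simp add: column_residual_def hinner_diff_left hinner_sum_left hinner_smult_left)
qed

lemma hinner_self_column_residual:
  "hinner (column_residual P q S j) (column_residual P q S j) =
    P $ j $ j - (\<Sum>i\<in>S. q i $ j * conj (q i $ j))"
proof -
  let ?r = "column_residual P q S j"
  have "hinner ?r ?r = hinner ?r (column j P) - (\<Sum>i\<in>S. q i $ j * hinner ?r (q i))"
    by (subst (2) column_residual_def)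
      (simp add: hinner_diff_right hinner_sum_right hinner_smult_right)
  also have "\<dots> = ?r $ j"
    by (simp add: hinner_column_residual hinner_column_projection projection_mult_column_residual)
  finally show ?thesis
    by (simp add: column_residual_def column_def mult.commute)
qed

text \<open>
  The defect in Parseval's identity, summed over the columns. It replaces dimension counting: the
  family \<open>q\<close> spans the range of \<open>P\<close> exactly when its size is the trace of \<open>P\<close>.
\<close>

lemma sum_norm_column_residual:
  "(\<Sum>j\<in>UNIV. of_real ((norm (column_residual P q S j))\<^sup>2)) = trace P - of_nat (card S)"
proof -
  have "(\<Sum>j\<in>UNIV. of_real ((norm (column_residual P q S j))\<^sup>2)) =
      trace P - (\<Sum>j\<in>UNIV. \<Sum>i\<in>S. q i $ j * conj (q i $ j))"
    unfolding hinner_self[symmetric] hinner_self_column_residual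
    by (simp add: sum_subtractf trace_def)
  also have "(\<Sum>j\<in>UNIV. \<Sum>i\<in>S. q i $ j * conj (q i $ j)) = (\<Sum>i\<in>S. hinner (q i) (q i))"
    unfolding hinner_def by (rule sum.swap)
  also have "\<dots> = of_nat (card S)"
    using q by (simp add: orthonormal_in_range_def)
  finally show ?thesis .
qed

lemma column_residuals_zero_iff:
  "(\<forall>j. column_residual P q S j = 0) \<longleftrightarrow> trace P = of_nat (card S)"
proof -
  have "(of_real (\<Sum>j\<in>UNIV. (norm (column_residual P q S j))\<^sup>2) :: 'a) = trace P - of_nat (card S)"
    using sum_norm_column_residual by simp
  then have "trace P = of_nat (card S) \<longleftrightarrow> (\<Sum>j\<in>UNIV. (norm (column_residual P q S j))\<^sup>2) = 0"
    by (metis eq_iff_diff_eq_0 of_real_eq_0_iff)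
  then show ?thesis
    by (simp add: sum_nonneg_eq_0_iff)
qed

end

lemma continuous_on_column_residual:
  fixes q :: "'i \<Rightarrow> 'a::involutive_normed_field^'k^'k \<Rightarrow> 'a^'k"
  assumes "\<And>i. i \<in> S \<Longrightarrow> continuous_on T (q i)"
  shows "continuous_on T (\<lambda>P. column_residual P (\<lambda>i. q i P) S j)"
  unfolding column_residual_def column_def vector_scalar_mult_def
  by (intro continuous_intros assms)

text \<open>
  Gram-Schmidt with parameters: an orthonormal basis of the range of \<open>P\<close> can be chosen
  continuously for the projections \<open>P\<close> near \<open>P0\<close> with the same trace. Each step normalizes a
  residual that is nonzero at \<open>P0\<close>, and shrinks the neighborhood so that it stays nonzero.
\<close>

lemma local_orthonormal_frame:
  fixes P0 :: "'a::involutive_normed_field^'k^'k" and S :: "'i set"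
  defines "R \<equiv> {P :: 'a^'k^'k. projection_matrix P \<and> trace P = trace P0}"
  assumes P0: "projection_matrix P0" and "finite S" and "of_nat (card S) = trace P0"
  obtains T and q :: "'i \<Rightarrow> 'a^'k^'k \<Rightarrow> 'a^'k"
  where "openin (top_of_set R) T" "P0 \<in> T" "\<And>i. i \<in> S \<Longrightarrow> continuous_on T (q i)"
    "\<And>P. P \<in> T \<Longrightarrow> orthonormal_in_range P (\<lambda>i. q i P) S"
proof -
  have "\<exists>T (q :: 'i \<Rightarrow> 'a^'k^'k \<Rightarrow> 'a^'k). openin (top_of_set R) T \<and> P0 \<in> T \<and>
      (\<forall>i\<in>S'. continuous_on T (q i)) \<and> (\<forall>P\<in>T. orthonormal_in_range P (\<lambda>i. q i P) S')"
    if "finite S'" "S' \<subseteq> S" for S'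
    using that
  proof (induction S' rule: finite_induct)
    case empty
    have "P0 \<in> R"
      by (simp add: R_def P0)
    then show ?case
      by (intro exI[of _ R]) (auto simp: orthonormal_in_range_def)
  next
    case (insert m S')
    then obtain T and q :: "'i \<Rightarrow> 'a^'k^'k \<Rightarrow> 'a^'k" where T: "openin (top_of_set R) T" "P0 \<in> T"
      and cont: "\<And>i. i \<in> S' \<Longrightarrow> continuous_on T (q i)"
      and q: "\<And>P. P \<in> T \<Longrightarrow> orthonormal_in_range P (\<lambda>i. q i P) S'"
      by (metis insert_subset)
    have proj: "projection_matrix P" if "P \<in> T" for P
      using that openin_imp_subset[OF T(1)] by (auto simp: R_def)
    have "card S' < card S"
      using insert \<open>finite S\<close> by (intro psubset_card_mono) auto
    then have "trace P0 \<noteq> of_nat (card S')"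
      using assms(4) by (metis less_irrefl of_nat_eq_iff)
    then obtain j where j: "column_residual P0 (\<lambda>i. q i P0) S' j \<noteq> 0"
      using column_residuals_zero_iff[OF P0 q[OF T(2)] \<open>finite S'\<close>] by blast
    define r where "r P = column_residual P (\<lambda>i. q i P) S' j" for P
    have cont_r: "continuous_on T r"
      unfolding r_def by (intro continuous_on_column_residual cont)
    define T' where "T' = T \<inter> r -` (- {0})"
    have "openin (top_of_set T) T'"
      unfolding T'_def by (intro continuous_openin_preimage_gen cont_r) auto
    then have "openin (top_of_set R) T'"
      using T(1) openin_trans by blast
    moreover have "P0 \<in> T'"
      using T j by (simp add: T'_def r_def)
    moreover define q' where "q' = q(m := \<lambda>P. inverse (norm (r P)) *\<^sub>R r P)"
    have "\<forall>i\<in>insert m S'. continuous_on T' (q' i)"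
    proof
      fix i assume "i \<in> insert m S'"
      moreover have "continuous_on T' (\<lambda>P. inverse (norm (r P)) *\<^sub>R r P)"
        by (intro continuous_intros continuous_on_subset[OF cont_r]) (auto simp: T'_def)
      moreover have "continuous_on T' (q i)" if "i \<in> S'"
        using cont[OF that] by (rule continuous_on_subset) (auto simp: T'_def)
      ultimately show "continuous_on T' (q' i)"
        by (auto simp: q'_def)
    qed
    moreover have "orthonormal_in_range P (\<lambda>i. q' i P) (insert m S')" if P: "P \<in> T'" for P
    proof -
      let ?u = "inverse (norm (r P)) *\<^sub>R r P"
      have PT: "P \<in> T" and r: "r P \<noteq> 0"
        using P by (auto simp: T'_def)
      note facts = proj[OF PT] q[OF PT] \<open>finite S'\<close>
      have "P *v ?u = ?u"
        using projection_mult_column_residual[OF facts, of j]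
        by (simp add: r_def scaleR_matrix_vector_mult_right)
      moreover have "hinner ?u ?u = 1"
        using r by (simp add: hinner_self)
      moreover have "hinner ?u (q l P) = 0" if "l \<in> S'" for l
        using hinner_column_residual[OF facts that, of j] by (simp add: r_def hinner_scaleR_left)
      moreover from this have "hinner (q l P) ?u = 0" if "l \<in> S'" for l
        using that by (metis conj_0 conj_hinner)
      ultimately show ?thesis
        using q[OF PT] \<open>m \<notin> S'\<close> by (auto simp: orthonormal_in_range_def q'_def)
    qed
    ultimately show ?case
      by blast
  qed
  from this[OF \<open>finite S\<close> subset_refl] show thesis
    using that by blast
qed

text \<open>
  The spectral form \<open>P = \<Sum>\<^sub>i q\<^sub>i q\<^sub>i\<^sup>*\<close>, entry by entry.
\<close>

lemma orthonormal_basis_of_range: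
  fixes P :: "'a::involutive_normed_field^'k^'k" and q :: "'i \<Rightarrow> 'a^'k"
  assumes "projection_matrix P" "orthonormal_in_range P q S" "finite S" "trace P = of_nat (card S)"
  shows "P $ a $ b = (\<Sum>i\<in>S. q i $ a * conj (q i $ b))"
proof -
  have "column_residual P q S b = 0"
    using column_residuals_zero_iff[OF assms(1-3)] assms(4) by blast
  from arg_cong[OF this, of "\<lambda>v. v $ a"] show ?thesis
    by (simp add: column_residual_def column_def mult.commute)
qed

section \<open>The Gram map is a fiber bundle\<close>

text \<open>
  The rows of \<open>s G\<close> are the conjugates of the local orthonormal basis of the range of
  \<open>(n/k) G\<close>, rescaled by \<open>sqrt (k/n)\<close>.
\<close>

lemma gram_local_section:
  fixes G0 :: "'a::involutive_normed_field^'k^'k"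
  assumes G0: "G0 \<in> scaled_projections CARD('n)"
  obtains T and s :: "'a^'k^'k \<Rightarrow> 'a^'k^'n"
  where "openin (top_of_set (scaled_projections CARD('n))) T" "G0 \<in> T" "continuous_on T s"
    "\<And>G. G \<in> T \<Longrightarrow> s G \<in> spherical_tight_frames" "\<And>G. G \<in> T \<Longrightarrow> gram (s G) = G"
proof -
  let ?c = "real CARD('n) / real CARD('k)" and ?d = "real CARD('k) / real CARD('n)"
  let ?p = "\<lambda>G :: 'a^'k^'k. ?c *\<^sub>R G"
  let ?SP = "scaled_projections CARD('n) :: ('a^'k^'k) set"
  have diag: "G $ i $ i = 1" and proj: "projection_matrix (?p G)"
    and trace: "trace (?p G) = of_nat (card (UNIV :: 'n set))"
    if "G \<in> ?SP" for G i
  proof -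
    from that obtain P where P: "G = ?d *\<^sub>R P" "projection_matrix P" "\<forall>i. P $ i $ i = of_real ?c"
      unfolding scaled_projections_def by blast
    show "projection_matrix (?p G)"
      using P by simp
    have diag: "G $ i $ i = 1" for i
      using P(3)[rule_format, of i] by (simp add: P(1) scaleR_conv_of_real[where 'a = 'a])
    then show "G $ i $ i = 1" .
    show "trace (?p G) = of_nat (card (UNIV :: 'n set))"
      by (simp add: trace_scaleR) (simp add: trace_def diag scaleR_conv_of_real[where 'a = 'a])
  qed
  define R where "R = {P :: 'a^'k^'k. projection_matrix P \<and> trace P = trace (?p G0)}"
  obtain T and q :: "'n \<Rightarrow> 'a^'k^'k \<Rightarrow> 'a^'k" where T: "openin (top_of_set R) T" "?p G0 \<in> T"
    and cont: "\<And>i. continuous_on T (q i)"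
    and q: "\<And>P. P \<in> T \<Longrightarrow> orthonormal_in_range P (\<lambda>i. q i P) UNIV"
    by (rule local_orthonormal_frame[OF proj[OF G0] finite trace[OF G0, symmetric],
          folded R_def]) blast
  define T' where "T' = ?SP \<inter> ?p -` T"
  define s :: "'a^'k^'k \<Rightarrow> 'a^'k^'n"
    where "s G = (\<chi> i l. sqrt ?d *\<^sub>R conj (q i (?p G) $ l))" for G
  have "?p \<in> ?SP \<rightarrow> R"
    using proj trace G0 by (auto simp: R_def)
  then have "openin (top_of_set ?SP) T'"
    unfolding T'_def by (intro continuous_openin_preimage[OF _ _ T(1)] continuous_intros)
  moreover have "G0 \<in> T'"
    using G0 T by (simp add: T'_def)
  moreover have "continuous_on T' s"
  proof -
    have "continuous_on T' (\<lambda>G. q i (?p G))" for i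
      by (rule continuous_on_compose2[OF cont[of i]]) (auto simp: T'_def intro!: continuous_intros)
    then show ?thesis
      unfolding s_def by (intro continuous_intros)
  qed
  moreover have "s G \<in> spherical_tight_frames" and "gram (s G) = G" if "G \<in> T'" for G
  proof -
    have G: "G \<in> ?SP" and ON: "orthonormal_in_range (?p G) (\<lambda>i. q i (?p G)) UNIV"
      using that q by (auto simp: T'_def)
    have "gram (s G) $ a $ b = G $ a $ b" for a b
    proof -
      have "gram (s G) $ a $ b = ?d *\<^sub>R (\<Sum>i\<in>UNIV. q i (?p G) $ a * conj (q i (?p G) $ b))"
        by (simp add: gram_def ctranspose_def matrix_matrix_mult_def s_def conj_scaleR
            scaleR_sum_right)
      also have "\<dots> = ?d *\<^sub>R (?p G $ a $ b)"
        by (simp only: orthonormal_basis_of_range[OF proj[OF G] ON finite trace[OF G]])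
      finally show ?thesis
        by simp
    qed
    then show gram: "gram (s G) = G"
      by (simp add: vec_eq_iff)
    have "(s G ** ctranspose (s G)) $ i $ j = ?d *\<^sub>R hinner (q j (?p G)) (q i (?p G))" for i j
      by (simp add: ctranspose_def matrix_matrix_mult_def s_def conj_scaleR
          scaleR_sum_right hinner_def mult.commute)
    then have "s G ** ctranspose (s G) = ?d *\<^sub>R mat 1"
      using ON by (simp add: vec_eq_iff orthonormal_in_range_def mat_def)
    then show "s G \<in> spherical_tight_frames"
      using diag[OF G] by (simp add: spherical_tight_frames_iff gram)
  qed
  ultimately show thesis
    using that by blast
qed

lemma gram_image_spherical_tight_frames:
  "gram ` (spherical_tight_frames :: ('a::involutive_normed_field^'k^'n) set) =
    scaled_projections CARD('n)"
proof
  show "gram ` (spherical_tight_frames :: ('a^'k^'n) set) \<subseteq> scaled_projections CARD('n)"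
    using gram_in_scaled_projections by blast
  show "scaled_projections CARD('n) \<subseteq> gram ` (spherical_tight_frames :: ('a^'k^'n) set)"
  proof
    fix G :: "'a^'k^'k" assume "G \<in> scaled_projections CARD('n)"
    then show "G \<in> gram ` (spherical_tight_frames :: ('a^'k^'n) set)"
      by (rule gram_local_section) (metis image_eqI)
  qed
qed

lemma continuous_on_gram: "continuous_on S (gram :: 'a::involutive_normed_field^'k^'n \<Rightarrow> _)"
  unfolding gram_def by (intro continuous_intros)

lemma gram_fiber_bundle:
  "fiber_bundle (top_of_set (spherical_tight_frames :: ('a::involutive_normed_field^'k^'n) set))
     (top_of_set (scaled_projections CARD('n)))
     (top_of_set (unitary_group :: ('a^'n^'n) set)) gram"
  unfolding fiber_bundle_def
proof (intro conjI ballI)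
  let ?STF = "spherical_tight_frames :: ('a^'k^'n) set"
  let ?SP = "scaled_projections CARD('n) :: ('a^'k^'k) set"
  let ?U = "unitary_group :: ('a^'n^'n) set"
  show "continuous_map (top_of_set ?STF) (top_of_set ?SP) gram"
    using gram_in_scaled_projections by (auto simp: continuous_on_gram continuous_map_in_subtopology)
  fix G0 assume "G0 \<in> topspace (top_of_set ?SP)"
  then have "G0 \<in> ?SP"
    by simp
  then obtain T and s :: "'a^'k^'k \<Rightarrow> 'a^'k^'n" where T: "openin (top_of_set ?SP) T" "G0 \<in> T"
    and cont: "continuous_on T s"
    and s: "\<And>G. G \<in> T \<Longrightarrow> s G \<in> ?STF" "\<And>G. G \<in> T \<Longrightarrow> gram (s G) = G"
    by (rule gram_local_section) blast
  define \<phi> where "\<phi> F =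
    (gram F, (real CARD('n) / real CARD('k)) *\<^sub>R (F ** ctranspose (s (gram F))))" for F :: "'a^'k^'n"
  define \<psi> :: "('a^'k^'k) \<times> ('a^'n^'n) \<Rightarrow> 'a^'k^'n"
    where "\<psi> = (\<lambda>(G, V). V ** s G)"
  let ?E = "{F \<in> ?STF. gram F \<in> T}"
  have sub: "subtopology (top_of_set ?STF) {F \<in> topspace (top_of_set ?STF). gram F \<in> T} = top_of_set ?E"
    by (simp add: subtopology_subtopology Collect_conj_eq Int_absorb1)
  have base: "subtopology (top_of_set ?SP) T = top_of_set T"
    using openin_imp_subset[OF T(1)] by (simp add: subtopology_subtopology Int_absorb1)
  have "homeomorphic_maps (top_of_set ?E) (prod_topology (top_of_set T) (top_of_set ?U)) \<phi> \<psi>"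
    unfolding homeomorphic_maps_def prod_topology_subtopology_eu
  proof (intro conjI)
    have "continuous_on ?E (\<lambda>F. s (gram F))"
      by (rule continuous_on_compose2[OF cont continuous_on_gram]) auto
    then have "continuous_on ?E \<phi>"
      unfolding \<phi>_def by (intro continuous_intros continuous_on_gram)
    moreover have "\<phi> F \<in> T \<times> ?U" if "F \<in> ?E" for F
      using that gram_eq_imp_transition_unitary(1)[of "s (gram F)" F] s by (auto simp: \<phi>_def)
    ultimately show "continuous_map (top_of_set ?E) (top_of_set (T \<times> ?U)) \<phi>"
      by (auto simp: continuous_map_in_subtopology)
    have "continuous_on (T \<times> ?U) \<psi>"
      unfolding \<psi>_def case_prod_unfold
      by (intro continuous_intros continuous_on_compose2[OF cont]) auto
    moreover have \<psi>: "\<psi> x \<in> ?E" "gram (\<psi> x) = fst x" if "x \<in> T \<times> ?U" for x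
      using that s by (auto simp: \<psi>_def gram_unitary_mult unitary_mult_spherical_tight_frame)
    ultimately show "continuous_map (top_of_set (T \<times> ?U)) (top_of_set ?E) \<psi>"
      by (auto simp: continuous_map_in_subtopology)
    show "\<forall>F\<in>topspace (top_of_set ?E). \<psi> (\<phi> F) = F"
      using gram_eq_imp_transition_unitary(2)[of "s (gram F)" F for F] s
      by (auto simp: \<phi>_def \<psi>_def)
    show "\<forall>x\<in>topspace (top_of_set (T \<times> ?U)). \<phi> (\<psi> x) = x"
    proof
      fix x assume "x \<in> topspace (top_of_set (T \<times> ?U))"
      then obtain G V where x: "x = (G, V)" "G \<in> T" "V \<in> ?U"
        by auto
      have "(V ** s G) ** ctranspose (s G) = V ** (s G ** ctranspose (s G))"
        by (simp add: matrix_mul_assoc)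
      also have "\<dots> = (real CARD('k) / real CARD('n)) *\<^sub>R V"
        using s(1)[OF x(2)] by (simp add: spherical_tight_frames_iff scaleR_matrix_mult_right)
      finally show "\<phi> (\<psi> x) = x"
        using s(2)[OF x(2)] x by (simp add: \<phi>_def \<psi>_def gram_unitary_mult)
    qed
  qed
  then have "homeomorphic_map (top_of_set ?E) (prod_topology (top_of_set T) (top_of_set ?U)) \<phi>"
    using homeomorphic_map_maps by blast
  then show "\<exists>T \<phi>. openin (top_of_set ?SP) T \<and> G0 \<in> T \<and>
      homeomorphic_map (subtopology (top_of_set ?STF) {F \<in> topspace (top_of_set ?STF). gram F \<in> T})
        (prod_topology (subtopology (top_of_set ?SP) T) (top_of_set ?U)) \<phi> \<and>
      (\<forall>F\<in>topspace (top_of_set ?STF). gram F \<in> T \<longrightarrow> fst (\<phi> F) = gram F)"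
    unfolding base[symmetric] sub[symmetric] using T
    by (intro exI[of _ T] exI[of _ \<phi>]) (simp add: \<phi>_def)
qed

section \<open>The base of a bundle as a quotient\<close>

lemma fiber_bundle_imp_open_map:
  assumes "fiber_bundle E B F p"
  shows "open_map E B p"
  unfolding open_map_def
proof (intro allI impI)
  fix W assume W: "openin E W"
  show "openin B (p ` W)"
  proof (subst openin_subopen, intro ballI)
    fix b assume "b \<in> p ` W"
    then obtain e where e: "e \<in> W" "b = p e"
      by blast
    have WE: "W \<subseteq> topspace E"
      using W openin_subset by blast
    have "continuous_map E B p"
      using assms by (simp add: fiber_bundle_def)
    then have "b \<in> topspace B"
      using e WE by (auto simp: continuous_map_def)
    then obtain U \<phi> where U: "openin B U" "b \<in> U"
      and \<phi>: "homeomorphic_map (subtopology E {e \<in> topspace E. p e \<in> U})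
        (prod_topology (subtopology B U) F) \<phi>"
      and fst: "\<And>e. e \<in> topspace E \<Longrightarrow> p e \<in> U \<Longrightarrow> fst (\<phi> e) = p e"
      using assms unfolding fiber_bundle_def by metis
    let ?W = "W \<inter> {e \<in> topspace E. p e \<in> U}"
    have "openin (subtopology E {e \<in> topspace E. p e \<in> U}) ?W"
      using W by (rule openin_subtopology_Int)
    then have "openin (prod_topology (subtopology B U) F) (\<phi> ` ?W)"
      using \<phi> homeomorphic_imp_open_map open_map_def by blast
    then have "openin (subtopology B U) (fst ` \<phi> ` ?W)"
      using open_map_fst open_map_def by blast
    then have "openin B (fst ` \<phi> ` ?W)"
      using U(1) openin_trans_full by blast
    moreover have "fst ` \<phi> ` ?W = p ` ?W"
      unfolding image_image using fst by (intro image_cong) auto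
    ultimately have "openin B (p ` ?W)"
      by simp
    moreover have "b \<in> p ` ?W"
      using e U WE by blast
    ultimately show "\<exists>V. openin B V \<and> b \<in> V \<and> V \<subseteq> p ` W"
      by (intro exI[of _ "p ` ?W"]) blast
  qed
qed

lemma quotient_maps_same_fibers_imp_homeomorphic_space:
  assumes f: "quotient_map X Y f" and g: "quotient_map X Z g"
    and fibers: "\<And>x y. x \<in> topspace X \<Longrightarrow> y \<in> topspace X \<Longrightarrow> f x = f y \<longleftrightarrow> g x = g y"
  shows "Y homeomorphic_space Z"
proof -
  obtain h where h: "continuous_map Y Z h" "\<And>x. x \<in> topspace X \<Longrightarrow> h (f x) = g x"
    using quotient_map_lift_exists[OF f quotient_imp_continuous_map[OF g]] fibers by metis
  obtain h' where h': "continuous_map Z Y h'" "\<And>x. x \<in> topspace X \<Longrightarrow> h' (g x) = f x"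
    using quotient_map_lift_exists[OF g quotient_imp_continuous_map[OF f]] fibers by metis
  have "homeomorphic_maps Y Z h h'"
    unfolding homeomorphic_maps_def
    using h h' quotient_imp_surjective_map[OF f] quotient_imp_surjective_map[OF g] by force
  then show ?thesis
    by (auto simp: homeomorphic_space_def)
qed

lemma scaled_projections_homeomorphic_orbit_space:
  "top_of_set (scaled_projections CARD('n) :: ('a::involutive_normed_field^'k^'k) set)
     homeomorphic_space
   quotient_topology (top_of_set (spherical_tight_frames :: ('a^'k^'n) set)) frame_orbit"
proof (rule quotient_maps_same_fibers_imp_homeomorphic_space[OF _ quotient_map_quotient_topology])
  let ?STF = "spherical_tight_frames :: ('a^'k^'n) set"
  let ?SP = "scaled_projections CARD('n) :: ('a^'k^'k) set"
  show "quotient_map (top_of_set ?STF) (top_of_set ?SP) gram"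
  proof (rule continuous_open_imp_quotient_map)
    show "continuous_map (top_of_set ?STF) (top_of_set ?SP) gram"
      using gram_fiber_bundle by (auto simp: fiber_bundle_def)
    show "open_map (top_of_set ?STF) (top_of_set ?SP) gram"
      using gram_fiber_bundle by (rule fiber_bundle_imp_open_map)
    show "gram ` topspace (top_of_set ?STF) = topspace (top_of_set ?SP)"
      by (simp add: gram_image_spherical_tight_frames)
  qed
  fix F F' assume "F \<in> topspace (top_of_set ?STF)" "F' \<in> topspace (top_of_set ?STF)"
  then show "gram F = gram F' \<longleftrightarrow> frame_orbit F = frame_orbit F'"
    by (auto simp: frame_orbit_eq_gram_fiber)
qed

theorem corollary2p6:
  assumes "CARD('n::finite) < CARD('k::finite)"
  shows
    "(gram ` (spherical_tight_frames :: (real^'k^'n) set) = scaled_projections CARD('n)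
      \<and> fiber_bundle
            (top_of_set (spherical_tight_frames :: (real^'k^'n) set))
            (top_of_set (scaled_projections CARD('n)))
            (top_of_set (unitary_group :: (real^'n^'n) set)) gram
      \<and> (\<forall>F \<in> spherical_tight_frames. \<forall>F' \<in> spherical_tight_frames.
            gram (F :: real^'k^'n) = gram F' \<longleftrightarrow> F' \<in> frame_orbit F)
      \<and> top_of_set (scaled_projections CARD('n) :: (real^'k^'k) set) homeomorphic_space
          quotient_topology (top_of_set (spherical_tight_frames :: (real^'k^'n) set)) frame_orbit)
     \<and>
     (gram ` (spherical_tight_frames :: (complex^'k^'n) set) = scaled_projections CARD('n)
      \<and> fiber_bundle
            (top_of_set (spherical_tight_frames :: (complex^'k^'n) set))
            (top_of_set (scaled_projections CARD('n)))
            (top_of_set (unitary_group :: (complex^'n^'n) set)) gram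
      \<and> (\<forall>F \<in> spherical_tight_frames. \<forall>F' \<in> spherical_tight_frames.
            gram (F :: complex^'k^'n) = gram F' \<longleftrightarrow> F' \<in> frame_orbit F)
      \<and> top_of_set (scaled_projections CARD('n) :: (complex^'k^'k) set) homeomorphic_space
          quotient_topology (top_of_set (spherical_tight_frames :: (complex^'k^'n) set)) frame_orbit)"
  by (intro conjI ballI gram_image_spherical_tight_frames gram_fiber_bundle
      scaled_projections_homeomorphic_orbit_space) (auto simp: frame_orbit_eq_gram_fiber)

end
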